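(* For every integer $n\geq 12$, there is a $3$-dicritical oriented graph with $n$ vertices and $\left\lceil \frac{5}{2}n\right\rceil$ arcs. In other words, $o_3(n) \leq \left\lceil \frac{5}{2}n \right\rceil$ for every $n \geq 12$.
   Context: Digraphs are finite, have no loops and no parallel arcs; two opposite arcs are allowed. An oriented graph is a digraph with no pair of opposite arcs. A subdigraph $D'$ of $D$ satisfies $V(D')\subseteq V(D)$, $A(D')\subseteq A(D)$; it is proper if $V(D')\neq V(D)$ or $A(D')\neq A(D)$. A $k$-dicolouring of a digraph is a colouring of its vertices with colours in $\{1,\dots,k\}$ such that each colour class induces an acyclic subdigraph. The dichromatic number $\vec{\chi}(D)$ is the least $k$ such that $D$ has a $k$-dicolouring. $D$ is $k$-dicritical if $\vec{\chi}(D)=k$ and $\vec{\chi}(D')<k$ for every proper subdigraph $D'$ of $D$. $o_k(n)$ denotes the minimum number of arcs of a $k$-dicritical oriented graph on $n$ vertices, with $o_k(n)=+\infty$ if there is none. *)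

theory Defs
  imports Complex_Main "HOL-Library.Extended_Nat" "Graph_Theory.Digraph_Component"
begin

text \<open>
  Digraphs are those of the locale \<^locale>\<open>digraph\<close>: finite, without loops and
  without parallel arcs, opposite arcs being allowed. Subdigraphs are given by
  \<^const>\<open>subgraph\<close>, and \<^const>\<open>induce_subgraph\<close> is the subdigraph induced by a
  vertex set.
\<close>

locale oriented_graph = digraph +
  assumes no_opposite_arcs: "u \<rightarrow>\<^bsub>G\<^esub> v \<Longrightarrow> \<not> v \<rightarrow>\<^bsub>G\<^esub> u"

definition proper_subdigraph :: "('a, 'b) pre_digraph \<Rightarrow> ('a, 'b) pre_digraph \<Rightarrow> bool" where
  "proper_subdigraph H D \<longleftrightarrow> subgraph H D \<and> (verts H \<noteq> verts D \<or> arcs H \<noteq> arcs D)"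

text \<open>
  \<^const>\<open>pre_digraph.cycle\<close> is a directed cycle; a pair of opposite arcs is a
  directed cycle of length two.
\<close>
definition acyclic_digraph :: "('a, 'b) pre_digraph \<Rightarrow> bool" where
  "acyclic_digraph D \<longleftrightarrow> \<not> (\<exists>p. pre_digraph.cycle D p)"

definition dicolouring :: "nat \<Rightarrow> ('a, 'b) pre_digraph \<Rightarrow> ('a \<Rightarrow> nat) \<Rightarrow> bool" where
  "dicolouring k D c \<longleftrightarrow>
     (\<forall>v \<in> verts D. c v \<in> {1..k}) \<and>
     (\<forall>i \<in> {1..k}. acyclic_digraph (D \<restriction> {v \<in> verts D. c v = i}))"

definition dichromatic_number :: "('a, 'b) pre_digraph \<Rightarrow> nat" where
  "dichromatic_number D = (LEAST k. \<exists>c. dicolouring k D c)"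

definition dicritical :: "nat \<Rightarrow> ('a, 'b) pre_digraph \<Rightarrow> bool" where
  "dicritical k D \<longleftrightarrow>
     digraph D \<and> dichromatic_number D = k \<and>
     (\<forall>H. proper_subdigraph H D \<longrightarrow> dichromatic_number H < k)"

text \<open>
  Every finite digraph without parallel arcs is isomorphic to one with vertices in
  \<^typ>\<open>nat\<close> and arcs in \<^typ>\<open>nat \<times> nat\<close>, so it suffices to range over these.
  In \<^typ>\<open>enat\<close> the infimum of a nonempty set is attained, and the infimum of the
  empty set is \<open>\<infinity>\<close>.
\<close>
definition min_arcs_dicritical_oriented :: "nat \<Rightarrow> nat \<Rightarrow> enat" where
  "min_arcs_dicritical_oriented k n =
     Inf {enat (card (arcs D)) | D :: (nat, nat \<times> nat) pre_digraph.
            oriented_graph D \<and> dicritical k D \<and> card (verts D) = n}"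

end

theory Submission
  imports Defs
begin

text \<open>
  Two constructions produce dicritical digraphs from smaller ones. For \<open>j \<ge> 1\<close>, call a digraph
  \<open>j\<close>-critical if it has no \<open>j\<close>-dicolouring but every proper subdigraph has one, so that
  \<open>j\<close>-critical means \<open>(j + 1)\<close>-dicritical; the \<open>1\<close>-critical digraphs used below are
  the directed cycles of length two (digons) and three.

  \<^item> Cone: if \<open>B\<close> is \<open>j\<close>-critical, then joining a new vertex to all vertices of \<open>B\<close> by digons
    gives a \<open>(j + 1)\<close>-critical digraph (lemma \<open>arc_critical_cone\<close>).
  \<^item> Digon expansion: let \<open>A\<close> be \<open>(j + 1)\<close>-critical and contain the digon \<open>x, y\<close>, and let \<open>B\<close> be
    \<open>j\<close>-critical and disjoint from \<open>A\<close>. Replace the arc from \<open>y\<close> to \<open>x\<close> by \<open>B\<close> together with all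
    arcs from \<open>y\<close> to \<open>B\<close> and from \<open>B\<close> to \<open>x\<close>. The result is \<open>(j + 1)\<close>-critical
    (lemma \<open>arc_critical_expand\<close>). Indeed, in a \<open>(j + 1)\<close>-dicolouring every colour occurs on \<open>B\<close>;
    if \<open>x\<close> and \<open>y\<close> had the same colour, a vertex \<open>t\<close> of \<open>B\<close> of that colour would close the
    monochromatic cycle \<open>x, y, t\<close>. So the new part still forces \<open>x\<close> and \<open>y\<close> to differ.

  Expanding with a digon adds 2 vertices and 5 arcs and leaves the number of digons unchanged;
  expanding with a directed triangle adds 3 vertices and 8 arcs and removes a digon. The cone
  over a digon is the complete digraph on 3 vertices, with 6 arcs and 3 digons; the cone over a
  directed triangle has 4 vertices, 9 arcs and also 3 digons. Applying \<open>k\<close> digon expansions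
  and then three triangle expansions destroys all digons and yields 3-dicritical oriented graphs
  with \<open>12 + 2 * k\<close> vertices and \<open>30 + 5 * k\<close> arcs, respectively \<open>13 + 2 * k\<close>
  vertices and \<open>33 + 5 * k\<close> arcs.
\<close>

section \<open>Acyclic relations\<close>

lemma acyclic_finite_rank:
  assumes "finite R" "acyclic R"
  shows "\<exists>f :: 'a \<Rightarrow> nat. \<forall>(u, v) \<in> R. f u < f v"
proof (intro exI ballI, clarify)
  fix u v assume uv: "(u, v) \<in> R"
  have "{w. (w, v) \<in> R\<^sup>+} \<subseteq> Domain (R\<^sup>+)" by blast
  moreover have "finite (Domain (R\<^sup>+))" using assms(1) by (simp add: finite_Domain)
  ultimately have "finite {w. (w, v) \<in> R\<^sup>+}" by (rule finite_subset)
  moreover have "{w. (w, u) \<in> R\<^sup>+} \<subset> {w. (w, v) \<in> R\<^sup>+}"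
  proof (intro psubsetI subsetI)
    fix w assume "w \<in> {w. (w, u) \<in> R\<^sup>+}"
    then show "w \<in> {w. (w, v) \<in> R\<^sup>+}" using trancl_into_trancl[OF _ uv] by simp
  next
    have "u \<in> {w. (w, v) \<in> R\<^sup>+}" "u \<notin> {w. (w, u) \<in> R\<^sup>+}"
      using uv assms(2) unfolding acyclic_def by auto
    then show "{w. (w, u) \<in> R\<^sup>+} \<noteq> {w. (w, v) \<in> R\<^sup>+}" by metis
  qed
  ultimately show "card {w. (w, u) \<in> R\<^sup>+} < card {w. (w, v) \<in> R\<^sup>+}"
    by (rule psubset_card_mono)
qed

lemma acyclic_lex_rank:
  fixes g :: "'a \<Rightarrow> nat \<times> nat"
  assumes "\<And>u v. (u, v) \<in> R \<Longrightarrow> (g u, g v) \<in> less_than <*lex*> less_than"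
  shows "acyclic R"
  by (rule acyclic_subset[OF wf_acyclic[of "inv_image (less_than <*lex*> less_than) g"]])
    (use assms in auto)

lemma acyclic_Un_oneway:
  assumes "finite R" "acyclic R" "Field R \<subseteq> U"
    and "finite Q" "acyclic Q" "Field Q \<subseteq> W"
    and "U \<inter> W = {}" and "N \<subseteq> R \<union> Q \<union> U \<times> W"
  shows "acyclic N"
proof -
  obtain f :: "'a \<Rightarrow> nat" where f: "\<forall>(u, v) \<in> R. f u < f v"
    using acyclic_finite_rank[OF assms(1,2)] by blast
  obtain h :: "'a \<Rightarrow> nat" where h: "\<forall>(u, v) \<in> Q. h u < h v"
    using acyclic_finite_rank[OF assms(4,5)] by blast
  have U: "v \<notin> U" if "v \<in> W" for v using that assms(7) by blast
  let ?g = "\<lambda>v. if v \<in> U then (0, f v) else (1, h v)"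
  show ?thesis
  proof (rule acyclic_lex_rank[where g = ?g])
    fix u v assume "(u, v) \<in> N"
    then consider "(u, v) \<in> R" | "(u, v) \<in> Q" | "u \<in> U" "v \<in> W" using assms(8) by blast
    then show "(?g u, ?g v) \<in> less_than <*lex*> less_than"
    proof cases
      case 1
      then have "u \<in> U" "v \<in> U" "f u < f v" using f assms(3) by (auto intro: FieldI1 FieldI2)
      then show ?thesis by simp
    next
      case 2
      then have "u \<in> W" "v \<in> W" "h u < h v" using h assms(6) by (auto intro: FieldI1 FieldI2)
      then show ?thesis using U by simp
    next
      case 3
      then show ?thesis using U by simp
    qed
  qed
qed

text \<open>
  \<open>R\<close> lives on \<open>U\<close> and \<open>Q\<close> on \<open>W\<close>; the remaining arcs only allow a detour from \<open>y\<close> through \<open>W\<close>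
  back to \<open>x\<close>, which acts like a single arc from \<open>y\<close> to \<open>x\<close>.
\<close>
lemma acyclic_Un_detour:
  assumes "finite R" "acyclic R" "Field R \<subseteq> U" "x \<in> U" "y \<in> U" "(x, y) \<notin> R\<^sup>*"
    and "finite Q" "acyclic Q" "Field Q \<subseteq> W"
    and "U \<inter> W = {}" and "N \<subseteq> R \<union> Q \<union> {y} \<times> W \<union> W \<times> {x}"
  shows "acyclic N"
proof -
  have "acyclic (insert (y, x) R)"
    using assms(2,6) by simp
  then obtain f :: "'a \<Rightarrow> nat" where f: "\<forall>(u, v) \<in> insert (y, x) R. f u < f v"
    using acyclic_finite_rank[of "insert (y, x) R"] assms(1) by blast
  obtain h :: "'a \<Rightarrow> nat" where h: "\<forall>(u, v) \<in> Q. h u < h v"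
    using acyclic_finite_rank[OF assms(7,8)] by blast
  have yx: "f y < f x" using f by simp
  have U: "v \<notin> U" if "v \<in> W" for v using that assms(10) by blast
  \<comment> \<open>The vertices of \<open>W\<close> are ranked between \<open>y\<close> and the next level of \<open>f\<close>, hence below \<open>x\<close>.\<close>
  let ?g = "\<lambda>v. if v \<in> U then (f v, 0) else (f y, Suc (h v))"
  show ?thesis
  proof (rule acyclic_lex_rank[where g = ?g])
    fix u v assume "(u, v) \<in> N"
    then consider "(u, v) \<in> R" | "(u, v) \<in> Q" | "u = y" "v \<in> W" | "u \<in> W" "v = x"
      using assms(11) by blast
    then show "(?g u, ?g v) \<in> less_than <*lex*> less_than"
    proof cases
      case 1
      then have "u \<in> U" "v \<in> U" "f u < f v" using f assms(3) by (auto intro: FieldI1 FieldI2)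
      then show ?thesis by simp
    next
      case 2
      then have "u \<in> W" "v \<in> W" "h u < h v" using h assms(9) by (auto intro: FieldI1 FieldI2)
      then show ?thesis using U by simp
    next
      case 3
      then show ?thesis using U assms(5) by simp
    next
      case 4
      then show ?thesis using U assms(4) yx by simp
    qed
  qed
qed

section \<open>Colourings of arc sets\<close>

text \<open>
  A digraph without isolated vertices is determined by its set of arcs, a relation whose
  \<^const>\<open>Field\<close> is the vertex set. The monochromatic arcs of a colouring are those
  whose two ends have the same colour.
\<close>
definition mono_arcs :: "('a \<Rightarrow> nat) \<Rightarrow> 'a rel \<Rightarrow> 'a rel" where
  "mono_arcs c A = {(u, v) \<in> A. c u = c v}"

text \<open>
  Existence of a \<open>k\<close>-dicolouring: all colour classes are acyclic iff the monochromatic arcs form an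
  acyclic relation, since a monochromatic path stays in one colour class. The colouring is
  defined on the whole type; for \<open>k > 0\<close> this is no restriction, and for \<open>k = 0\<close> nothing is
  colourable, not even the empty set.
\<close>
definition colourable :: "nat \<Rightarrow> 'a rel \<Rightarrow> bool" where
  "colourable k A \<longleftrightarrow> (\<exists>c. (\<forall>v. c v \<in> {1..k}) \<and> acyclic (mono_arcs c A))"

text \<open>
  Minimal arc sets without a \<open>k\<close>-dicolouring. For \<open>k \<ge> 1\<close> they are the arc sets of
  \<open>(k + 1)\<close>-dicritical digraphs: note the shift by one.
\<close>
definition arc_critical :: "nat \<Rightarrow> 'a rel \<Rightarrow> bool" where
  "arc_critical k A \<longleftrightarrow>
     finite A \<and> irrefl A \<and> \<not> colourable k A \<and> (\<forall>e \<in> A. colourable k (A - {e}))"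

lemma mono_arcs_subset: "mono_arcs c A \<subseteq> A"
  by (auto simp: mono_arcs_def)

lemma mono_arcs_mono: "A \<subseteq> B \<Longrightarrow> mono_arcs c A \<subseteq> mono_arcs c B"
  by (auto simp: mono_arcs_def)

lemma finite_mono_arcs: "finite A \<Longrightarrow> finite (mono_arcs c A)"
  using finite_subset[OF mono_arcs_subset] .

lemma Field_mono_arcs: "Field (mono_arcs c A) \<subseteq> Field A"
  by (rule mono_Field[OF mono_arcs_subset])

lemma mono_arcs_rtrancl: "(u, v) \<in> (mono_arcs c A)\<^sup>* \<Longrightarrow> c u = c v"
  by (induction rule: rtrancl_induct) (auto simp: mono_arcs_def)

lemma colourable_mono:
  assumes "colourable k B" "A \<subseteq> B" shows "colourable k A"
  using assms acyclic_subset[OF _ mono_arcs_mono] unfolding colourable_def by blast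

text \<open>Only the number of colours matters, not the colours themselves.\<close>
lemma colourableI_palette:
  assumes "acyclic (mono_arcs c A)" "c ` Field A \<subseteq> S" "finite S" "card S \<le> k" "k \<ge> 1"
  shows "colourable k A"
proof -
  obtain p where p: "p ` S \<subseteq> {1..k}" "inj_on p S"
    using card_le_inj[of S "{1..k}"] assms by auto
  define d where "d v = (if c v \<in> S then p (c v) else 1)" for v
  have "mono_arcs d A = mono_arcs c A"
  proof -
    have "c u \<in> S" "c v \<in> S" if "(u, v) \<in> A" for u v
      by (rule subsetD[OF assms(2) imageI[OF FieldI1[OF that]]],
          rule subsetD[OF assms(2) imageI[OF FieldI2[OF that]]])
    then show ?thesis using inj_on_eq_iff[OF p(2)] unfolding mono_arcs_def d_def by auto
  qed
  moreover have "d v \<in> {1..k}" for v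
    using p assms(5) by (auto simp: d_def)
  ultimately show ?thesis
    using assms(1) unfolding colourable_def by metis
qed

lemma colourable_palette:
  assumes "colourable k A" "finite S" "card S = k"
  obtains c where "\<And>v. c v \<in> S" "acyclic (mono_arcs c A)"
proof -
  obtain c where c: "\<forall>v. c v \<in> {1..k}" "acyclic (mono_arcs c A)"
    using assms(1) by (auto simp: colourable_def)
  obtain p where p: "bij_betw p {1..k} S"
    using finite_same_card_bij[of "{1..k}" S] assms by auto
  have "p (c u) = p (c v) \<longleftrightarrow> c u = c v" for u v
    using inj_on_eq_iff[OF bij_betw_imp_inj_on[OF p]] c(1) by blast
  then have "mono_arcs (p \<circ> c) A = mono_arcs c A"
    by (simp add: mono_arcs_def)
  moreover have "(p \<circ> c) v \<in> S" for v
    using bij_betwE[OF p] c(1) by simp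
  ultimately show thesis using that[of "p \<circ> c"] c by simp
qed

lemma arc_critical_colour_used:
  assumes "arc_critical j B" "j \<ge> 1" "\<forall>v. c v \<in> {1..Suc j}" "acyclic (mono_arcs c B)"
    and "i \<in> {1..Suc j}"
  obtains t where "t \<in> Field B" "c t = i"
proof (rule ccontr)
  assume "\<not> thesis"
  then have "c ` Field B \<subseteq> {1..Suc j} - {i}" using assms(3) that by blast
  moreover have "card ({1..Suc j} - {i}) \<le> j" using assms(5) by simp
  ultimately have "colourable j B"
    using colourableI_palette[OF assms(4)] assms(2) by blast
  then show False using assms(1) by (simp add: arc_critical_def)
qed

text \<open>
  With one colour more than it forbids, a critical arc set can be coloured so that a prescribed
  colour occurs at exactly one prescribed vertex: arcs at \<open>t\<close> are then never monochromatic,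
  so a colouring of the other arcs by the other colours suffices.
\<close>
lemma arc_critical_unique_colour:
  assumes "arc_critical j B" "t \<in> Field B" "i \<in> {1..Suc j}"
  obtains d where "\<And>v. d v \<in> {1..Suc j}" "\<And>v. d v = i \<longleftrightarrow> v = t" "acyclic (mono_arcs d B)"
proof -
  obtain e where e: "e \<in> B" "fst e = t \<or> snd e = t"
    using assms(2) by (auto simp: Field_def)
  have cS: "card ({1..Suc j} - {i}) = j" using assms(3) by simp
  obtain c where c: "\<And>v. c v \<in> {1..Suc j} - {i}" "acyclic (mono_arcs c (B - {e}))"
    using colourable_palette[OF _ _ cS] e(1) assms(1) unfolding arc_critical_def by blast
  have irr: "(t, t) \<notin> B" using assms(1) by (auto simp: arc_critical_def irrefl_def)
  have ci: "c v \<noteq> i" for v using c(1) by blast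
  have "mono_arcs (c(t := i)) B \<subseteq> mono_arcs c (B - {e})"
    using e(2) irr ci by (force simp: mono_arcs_def split: if_splits)
  then have "acyclic (mono_arcs (c(t := i)) B)" using acyclic_subset[OF c(2)] by blast
  then show thesis using that[of "c(t := i)"] c(1) ci assms(3) by force
qed

lemma arc_critical_avoid_colour:
  assumes "arc_critical j B" "e \<in> B" "i \<in> {1..Suc j}"
  obtains d where "\<And>v. d v \<in> {1..Suc j}" "\<And>v. d v \<noteq> i" "acyclic (mono_arcs d (B - {e}))"
proof -
  have cS: "card ({1..Suc j} - {i}) = j" using assms(3) by simp
  obtain c where "\<And>v. c v \<in> {1..Suc j} - {i}" "acyclic (mono_arcs c (B - {e}))"
    using colourable_palette[OF _ _ cS] assms(1,2) unfolding arc_critical_def by blast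
  then show thesis using that by blast
qed

lemma arc_critical_coloured:
  assumes "arc_critical j B"
  obtains d where "\<And>v. d v \<in> {1..Suc j}" "acyclic (mono_arcs d B)"
proof (cases "Field B = {}")
  case True
  then have "B = {}" using FieldI1 by fastforce
  then show thesis using that[of "\<lambda>_. 1"] by (simp add: mono_arcs_def acyclic_def)
next
  case False
  then obtain t where t: "t \<in> Field B" by blast
  have one: "1 \<in> {1..Suc j}" by simp
  show thesis
    by (rule arc_critical_unique_colour[OF assms t one]) (rule that)
qed

section \<open>Two constructions of critical arc sets\<close>

text \<open>The digraph \<open>B\<close> with an additional vertex \<open>v\<close> joined to every vertex of \<open>B\<close> by a digon.\<close>
definition cone :: "'a \<Rightarrow> 'a rel \<Rightarrow> 'a rel" where
  "cone v B = B \<union> {v} \<times> Field B \<union> Field B \<times> {v}"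

text \<open>
  The expansion of the digon \<open>x, y\<close> of \<open>A\<close> by \<open>B\<close>: the arc from \<open>x\<close> to \<open>y\<close> is kept, the opposite one
  is replaced by \<open>B\<close> and all paths of length two from \<open>y\<close> through a vertex of \<open>B\<close> to \<open>x\<close>.
\<close>
definition expand :: "'a \<Rightarrow> 'a \<Rightarrow> 'a rel \<Rightarrow> 'a rel \<Rightarrow> 'a rel" where
  "expand x y A B = (A - {(y, x)}) \<union> B \<union> {y} \<times> Field B \<union> Field B \<times> {x}"

lemma finite_cone: "finite B \<Longrightarrow> finite (cone v B)"
  by (simp add: cone_def finite_Field)

lemma finite_expand: "finite A \<Longrightarrow> finite B \<Longrightarrow> finite (expand x y A B)"
  by (simp add: expand_def finite_Field)

lemma arc_critical_cone:
  assumes B: "arc_critical j B" and "j \<ge> 1" and v: "v \<notin> Field B"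
  shows "arc_critical (Suc j) (cone v B)"
proof -
  have fin: "finite B" and irr: "irrefl B" using B by (auto simp: arc_critical_def)
  have "\<not> colourable (Suc j) (cone v B)"
  proof
    assume "colourable (Suc j) (cone v B)"
    then obtain c where c: "\<forall>u. c u \<in> {1..Suc j}" "acyclic (mono_arcs c (cone v B))"
      by (auto simp: colourable_def)
    have "mono_arcs c B \<subseteq> mono_arcs c (cone v B)" by (auto simp: mono_arcs_def cone_def)
    then have "acyclic (mono_arcs c B)" using acyclic_subset[OF c(2)] by blast
    then obtain t where t: "t \<in> Field B" "c t = c v"
      using arc_critical_colour_used[OF B assms(2) c(1)] c(1) by metis
    then have "(v, t) \<in> mono_arcs c (cone v B)" "(t, v) \<in> mono_arcs c (cone v B)"
      by (auto simp: mono_arcs_def cone_def)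
    then have "(v, v) \<in> (mono_arcs c (cone v B))\<^sup>+"
      by (rule trancl_into_trancl[OF r_into_trancl])
    then show False using c(2) by (auto simp: acyclic_def)
  qed
  moreover have "colourable (Suc j) (cone v B - {e})" if e: "e \<in> cone v B" for e
  proof -
    have S: "Suc j \<in> {1..Suc j}" by simp
    let ?d = "\<lambda>d. d(v := Suc j)"
    have vB: "u \<noteq> v" if "u \<in> Field B" for u using that v by blast
    have glued: "mono_arcs (?d d) (cone v B - {e}) \<subseteq> mono_arcs d (B - {e})
        \<union> {(v, t) | t. t \<in> Field B \<and> d t = Suc j \<and> (v, t) \<noteq> e}
        \<union> {(t, v) | t. t \<in> Field B \<and> d t = Suc j \<and> (t, v) \<noteq> e}" for d
    proof (rule subrelI)
      fix u w assume "(u, w) \<in> mono_arcs (?d d) (cone v B - {e})"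
      then have m: "(u, w) \<in> cone v B" "(u, w) \<noteq> e" "?d d u = ?d d w"
        by (simp_all add: mono_arcs_def)
      consider (B) "(u, w) \<in> B" | (out) "u = v" "w \<in> Field B" | (into) "u \<in> Field B" "w = v"
        using m(1) unfolding cone_def by blast
      then show "(u, w) \<in> mono_arcs d (B - {e})
        \<union> {(v, t) | t. t \<in> Field B \<and> d t = Suc j \<and> (v, t) \<noteq> e}
        \<union> {(t, v) | t. t \<in> Field B \<and> d t = Suc j \<and> (t, v) \<noteq> e}"
      proof cases
        case B
        then show ?thesis using m(2,3) vB[OF FieldI1] vB[OF FieldI2] by (simp add: mono_arcs_def)
      next
        case out
        then show ?thesis using m(2,3) vB by simp
      next
        case into
        then show ?thesis using m(2,3) vB by simp
      qed
    qed
    have mono_B: "finite (mono_arcs d B')" "Field (mono_arcs d B') \<subseteq> Field B" if "B' \<subseteq> B"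
      for d :: "'a \<Rightarrow> nat" and B'
      using finite_mono_arcs[OF finite_subset[OF that fin]]
        subset_trans[OF Field_mono_arcs mono_Field[OF that]] by blast+
    have colour: "colourable (Suc j) (cone v B - {e})"
      if "\<And>u. d u \<in> {1..Suc j}" "acyclic (mono_arcs (?d d) (cone v B - {e}))" for d
      unfolding colourable_def using that by (intro exI[of _ "?d d"]) simp
    have V: "Field {} \<subseteq> {v}" "acyclic {}" "Field B \<inter> {v} = {}" "{v} \<inter> Field B = {}"
      using v by (simp_all add: acyclic_def)
    \<comment> \<open>In all three cases below, \<open>v\<close> receives the colour \<open>Suc j\<close>, and the monochromatic arcs at \<open>v\<close>
      all leave \<open>v\<close> or all enter \<open>v\<close>.\<close>
    consider (inner) "e \<in> B" | (out) t where "t \<in> Field B" "e = (v, t)"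
      | (into) t where "t \<in> Field B" "e = (t, v)"
      using e unfolding cone_def by blast
    then show ?thesis
    proof cases
      case inner
      obtain d where d: "\<And>u. d u \<in> {1..Suc j}" "\<And>u. d u \<noteq> Suc j" "acyclic (mono_arcs d (B - {e}))"
        using arc_critical_avoid_colour[OF B inner S] by metis
      have "mono_arcs (?d d) (cone v B - {e})
          \<subseteq> mono_arcs d (B - {e}) \<union> {} \<union> Field B \<times> {v}"
        using glued[of d] d(2) by blast
      then show ?thesis
        by (rule colour[OF d(1) acyclic_Un_oneway[OF mono_B(1)[OF Diff_subset] d(3)
              mono_B(2)[OF Diff_subset] finite.emptyI V(2,1,3)]])
    next
      case out
      obtain d where d: "\<And>u. d u \<in> {1..Suc j}" "\<And>u. d u = Suc j \<longleftrightarrow> u = t" "acyclic (mono_arcs d B)"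
        using arc_critical_unique_colour[OF B out(1) S] by metis
      have no: "\<not> (d s = Suc j \<and> (v, s) \<noteq> e)" for s
        using d(2)[of s] out(2) by simp
      have "mono_arcs (?d d) (cone v B - {e}) \<subseteq> mono_arcs d B \<union> {} \<union> Field B \<times> {v}"
        using glued[of d] no mono_arcs_mono[OF Diff_subset[of B "{e}"], of d] by blast
      then show ?thesis
        by (rule colour[OF d(1) acyclic_Un_oneway[OF mono_B(1)[OF order_refl] d(3)
              mono_B(2)[OF order_refl] finite.emptyI V(2,1,3)]])
    next
      case into
      obtain d where d: "\<And>u. d u \<in> {1..Suc j}" "\<And>u. d u = Suc j \<longleftrightarrow> u = t" "acyclic (mono_arcs d B)"
        using arc_critical_unique_colour[OF B into(1) S] by metis
      have no: "\<not> (d s = Suc j \<and> (s, v) \<noteq> e)" for s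
        using d(2)[of s] into(2) by simp
      have "mono_arcs (?d d) (cone v B - {e}) \<subseteq> {} \<union> mono_arcs d B \<union> {v} \<times> Field B"
        using glued[of d] no mono_arcs_mono[OF Diff_subset[of B "{e}"], of d] by blast
      then show ?thesis
        by (rule colour[OF d(1) acyclic_Un_oneway[OF finite.emptyI V(2,1) mono_B(1)[OF order_refl]
              d(3) mono_B(2)[OF order_refl] V(4)]])
    qed
  qed
  moreover have "irrefl (cone v B)" using irr v by (auto simp: irrefl_def cone_def)
  ultimately show ?thesis using finite_cone[OF fin] by (simp add: arc_critical_def)
qed

text \<open>
  Colourability after deleting an arc \<open>e\<close>. If \<open>e\<close> is an arc of \<open>A\<close>, colour \<open>A\<close> without \<open>e\<close>: as the arc
  from \<open>y\<close> to \<open>x\<close> is present there, no monochromatic path leads from \<open>x\<close> to \<open>y\<close>, so any colouring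
  of \<open>B\<close> fits. Otherwise colour \<open>A\<close> without the arc from \<open>y\<close> to \<open>x\<close>, and colour \<open>B\<close> so that no
  monochromatic arc leaves \<open>y\<close> towards \<open>B\<close>, or none enters \<open>x\<close> from \<open>B\<close>.
\<close>
lemma arc_critical_expand:
  assumes A: "arc_critical (Suc j) A" and B: "arc_critical j B" and "j \<ge> 1"
    and disj: "Field A \<inter> Field B = {}" and xy: "(x, y) \<in> A" and yx: "(y, x) \<in> A"
  shows "arc_critical (Suc j) (expand x y A B)"
proof -
  let ?C = "expand x y A B"
  have fin: "finite A" "finite B" and irr: "irrefl A" "irrefl B"
    using A B unfolding arc_critical_def by blast+
  have xyF: "x \<in> Field A" "y \<in> Field A" using xy by (auto simp: Field_def)
  have nxy: "x \<noteq> y" using xy irr by (auto simp: irrefl_def)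
  have "\<not> colourable (Suc j) ?C"
  proof
    assume "colourable (Suc j) ?C"
    then obtain c where c: "\<forall>u. c u \<in> {1..Suc j}" "acyclic (mono_arcs c ?C)"
      by (auto simp: colourable_def)
    \<comment> \<open>If the colours of \<open>x\<close> and \<open>y\<close> differ, the missing arc is not monochromatic, and \<open>A\<close> itself
      would be coloured.\<close>
    have cxy: "c x = c y"
    proof (rule ccontr)
      assume "c x \<noteq> c y"
      then have "mono_arcs c A \<subseteq> mono_arcs c ?C" unfolding mono_arcs_def expand_def by auto
      then have "acyclic (mono_arcs c A)" using acyclic_subset[OF c(2)] by blast
      then show False using c(1) A unfolding arc_critical_def colourable_def by blast
    qed
    have "mono_arcs c B \<subseteq> mono_arcs c ?C" by (auto simp: mono_arcs_def expand_def)
    then have "acyclic (mono_arcs c B)" using acyclic_subset[OF c(2)] by blast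
    then obtain t where t: "t \<in> Field B" "c t = c y"
      using arc_critical_colour_used[OF B assms(3) c(1)] c(1) by metis
    have "(x, y) \<in> mono_arcs c ?C" "(y, t) \<in> mono_arcs c ?C" "(t, x) \<in> mono_arcs c ?C"
      using t cxy xy nxy by (auto simp: mono_arcs_def expand_def)
    then have "(x, x) \<in> (mono_arcs c ?C)\<^sup>+"
      by (rule trancl_into_trancl[OF trancl_into_trancl[OF r_into_trancl]])
    then show False using c(2) by (auto simp: acyclic_def)
  qed
  moreover have "colourable (Suc j) (?C - {e})" if e: "e \<in> ?C" for e
  proof -
    have glue: "colourable (Suc j) (?C - {e})"
      if c: "\<And>u. c u \<in> {1..Suc j}" and d: "\<And>u. d u \<in> {1..Suc j}"
        and ac: "acyclic (mono_arcs (\<lambda>u. if u \<in> Field B then d u else c u) (?C - {e}))" for c d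
      unfolding colourable_def using c d ac
      by (intro exI[of _ "\<lambda>u. if u \<in> Field B then d u else c u"]) auto
    have glued: "mono_arcs (\<lambda>u. if u \<in> Field B then d u else c u) (?C - {e})
        \<subseteq> mono_arcs c (A - {(y, x)} - {e}) \<union> mono_arcs d (B - {e})
           \<union> {(y, t) | t. t \<in> Field B \<and> c y = d t \<and> (y, t) \<noteq> e}
           \<union> {(t, x) | t. t \<in> Field B \<and> c x = d t \<and> (t, x) \<noteq> e}" for c d :: "'a \<Rightarrow> nat"
    proof (rule subrelI)
      let ?h = "\<lambda>u. if u \<in> Field B then d u else c u"
      fix u w assume "(u, w) \<in> mono_arcs ?h (?C - {e})"
      then have m: "(u, w) \<in> ?C" "(u, w) \<noteq> e" "?h u = ?h w" by (auto simp: mono_arcs_def)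
      have hA: "?h v = c v" if "v \<in> Field A" for v using that disj by auto
      consider (A) "(u, w) \<in> A - {(y, x)}" | (B) "(u, w) \<in> B" | (y) "u = y" "w \<in> Field B"
        | (x) "u \<in> Field B" "w = x"
        using m(1) unfolding expand_def by blast
      then show "(u, w) \<in> mono_arcs c (A - {(y, x)} - {e}) \<union> mono_arcs d (B - {e})
           \<union> {(y, t) | t. t \<in> Field B \<and> c y = d t \<and> (y, t) \<noteq> e}
           \<union> {(t, x) | t. t \<in> Field B \<and> c x = d t \<and> (t, x) \<noteq> e}"
      proof cases
        case A
        then have "u \<in> Field A" "w \<in> Field A" by (auto intro: FieldI1 FieldI2)
        then have "c u = c w" using m(3) hA by metis
        then show ?thesis using A m(2) by (simp add: mono_arcs_def)
      next
        case B
        then have "u \<in> Field B" "w \<in> Field B" by (auto intro: FieldI1 FieldI2)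
        then have "d u = d w" using m(3) by simp
        then show ?thesis using B m(2) by (simp add: mono_arcs_def)
      next
        case y
        then have "c y = d w" using m(3) hA[OF xyF(2)] by metis
        then show ?thesis using y m(2) by blast
      next
        case x
        then have "c x = d u" using m(3) hA[OF xyF(1)] by metis
        then show ?thesis using x m(2) by blast
      qed
    qed
    have mono_A: "finite (mono_arcs c A')" "Field (mono_arcs c A') \<subseteq> Field A" if "A' \<subseteq> A"
      for c :: "'a \<Rightarrow> nat" and A'
      using finite_subset[OF that fin(1)] finite_mono_arcs Field_mono_arcs[of c A'] mono_Field[OF that]
      by auto
    have mono_B: "finite (mono_arcs c B')" "Field (mono_arcs c B') \<subseteq> Field B" if "B' \<subseteq> B"
      for c :: "'a \<Rightarrow> nat" and B'
      using finite_subset[OF that fin(2)] finite_mono_arcs Field_mono_arcs[of c B'] mono_Field[OF that]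
      by auto
    obtain c0 where c0: "\<And>u. c0 u \<in> {1..Suc j}" "acyclic (mono_arcs c0 (A - {(y, x)}))"
      using A yx unfolding arc_critical_def colourable_def by blast
    have c0e: "acyclic (mono_arcs c0 (A - {(y, x)} - {e}))"
      by (rule acyclic_subset[OF c0(2) mono_arcs_mono]) auto
    consider (old) "e \<in> A" "e \<noteq> (y, x)" | (inner) "e \<in> B"
      | (out) t where "t \<in> Field B" "e = (y, t)" | (into) t where "t \<in> Field B" "e = (t, x)"
      using e by (auto simp: expand_def)
    then show ?thesis
    proof cases
      case old
      obtain c where c: "\<And>u. c u \<in> {1..Suc j}" "acyclic (mono_arcs c (A - {e}))"
        using A old(1) unfolding arc_critical_def colourable_def by blast
      obtain d where d: "\<And>u. d u \<in> {1..Suc j}" "acyclic (mono_arcs d B)"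
        using arc_critical_coloured[OF B] by metis
      let ?R = "mono_arcs c (A - {(y, x)} - {e})"
      have sub: "?R \<subseteq> mono_arcs c (A - {e})" by (auto simp: mono_arcs_def)
      have acR: "acyclic ?R" by (rule acyclic_subset[OF c(2) sub])
      have np: "(x, y) \<notin> ?R\<^sup>*"
      proof
        assume "(x, y) \<in> ?R\<^sup>*"
        then have path: "c x = c y" "(x, y) \<in> (mono_arcs c (A - {e}))\<^sup>*"
          by (rule mono_arcs_rtrancl, rule subsetD[OF rtrancl_mono[OF sub]])
        have "(y, x) \<in> mono_arcs c (A - {e})"
          using yx old(2) path(1) by (auto simp: mono_arcs_def)
        then have "(y, y) \<in> (mono_arcs c (A - {e}))\<^sup>+"
          using path(2) by (rule rtrancl_into_trancl2)
        then show False using c(2) by (auto simp: acyclic_def)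
      qed
      have R: "finite ?R" "Field ?R \<subseteq> Field A" by (rule mono_A, blast)+
      have Q: "finite (mono_arcs d B)" "Field (mono_arcs d B) \<subseteq> Field B" by (rule mono_B, blast)+
      show ?thesis
      proof (rule glue[OF c(1) d(1)], rule acyclic_Un_detour[OF R(1) acR R(2) xyF np Q(1) d(2) Q(2) disj])
        show "mono_arcs (\<lambda>u. if u \<in> Field B then d u else c u) (?C - {e})
          \<subseteq> ?R \<union> mono_arcs d B \<union> {y} \<times> Field B \<union> Field B \<times> {x}"
          using glued[of d c] mono_arcs_mono[of "B - {e}" B d] by blast
      qed
    next
      case inner
      obtain d where d: "\<And>u. d u \<in> {1..Suc j}" "\<And>u. d u \<noteq> c0 x" "acyclic (mono_arcs d (B - {e}))"
        using arc_critical_avoid_colour[OF B inner c0(1)[of x]] by metis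
      have R: "finite (mono_arcs c0 (A - {(y, x)} - {e}))"
        "Field (mono_arcs c0 (A - {(y, x)} - {e})) \<subseteq> Field A" by (rule mono_A, blast)+
      have Q: "finite (mono_arcs d (B - {e}))" "Field (mono_arcs d (B - {e})) \<subseteq> Field B"
        by (rule mono_B, blast)+
      have no: "c0 x \<noteq> d s" for s
        using d(2)[of s] by simp
      show ?thesis
      proof (rule glue[OF c0(1) d(1)], rule acyclic_Un_oneway[OF R(1) c0e R(2) Q(1) d(3) Q(2) disj])
        show "mono_arcs (\<lambda>u. if u \<in> Field B then d u else c0 u) (?C - {e})
          \<subseteq> mono_arcs c0 (A - {(y, x)} - {e}) \<union> mono_arcs d (B - {e}) \<union> Field A \<times> Field B"
          using glued[of d c0] no xyF by blast
      qed
    next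
      case out
      obtain d where d: "\<And>u. d u \<in> {1..Suc j}" "\<And>u. d u = c0 y \<longleftrightarrow> u = t" "acyclic (mono_arcs d B)"
        using arc_critical_unique_colour[OF B out(1) c0(1)[of y]] by metis
      have R: "finite (mono_arcs c0 (A - {(y, x)} - {e}))"
        "Field (mono_arcs c0 (A - {(y, x)} - {e})) \<subseteq> Field A" by (rule mono_A, blast)+
      have Q: "finite (mono_arcs d B)" "Field (mono_arcs d B) \<subseteq> Field B"
        by (rule mono_B, blast)+
      have no: "\<not> (s \<in> Field B \<and> c0 y = d s \<and> (y, s) \<noteq> e)" for s
        using d(2)[of s] out(2) by auto
      show ?thesis
      proof (rule glue[OF c0(1) d(1)],
          rule acyclic_Un_oneway[OF Q(1) d(3) Q(2) R(1) c0e R(2)])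
        show "mono_arcs (\<lambda>u. if u \<in> Field B then d u else c0 u) (?C - {e})
          \<subseteq> mono_arcs d B \<union> mono_arcs c0 (A - {(y, x)} - {e}) \<union> Field B \<times> Field A"
          using glued[of d c0] no mono_arcs_mono[of "B - {e}" B d] xyF by blast
      qed (use disj in blast)
    next
      case into
      obtain d where d: "\<And>u. d u \<in> {1..Suc j}" "\<And>u. d u = c0 x \<longleftrightarrow> u = t" "acyclic (mono_arcs d B)"
        using arc_critical_unique_colour[OF B into(1) c0(1)[of x]] by metis
      have R: "finite (mono_arcs c0 (A - {(y, x)} - {e}))"
        "Field (mono_arcs c0 (A - {(y, x)} - {e})) \<subseteq> Field A" by (rule mono_A, blast)+
      have Q: "finite (mono_arcs d B)" "Field (mono_arcs d B) \<subseteq> Field B"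
        by (rule mono_B, blast)+
      have no: "\<not> (s \<in> Field B \<and> c0 x = d s \<and> (s, x) \<noteq> e)" for s
        using d(2)[of s] into(2) by auto
      show ?thesis
      proof (rule glue[OF c0(1) d(1)],
          rule acyclic_Un_oneway[OF R(1) c0e R(2) Q(1) d(3) Q(2) disj])
        show "mono_arcs (\<lambda>u. if u \<in> Field B then d u else c0 u) (?C - {e})
          \<subseteq> mono_arcs c0 (A - {(y, x)} - {e}) \<union> mono_arcs d B \<union> Field A \<times> Field B"
          using glued[of d c0] no mono_arcs_mono[of "B - {e}" B d] xyF by blast
      qed
    qed
  qed
  moreover have "irrefl ?C"
    using irr disj xyF unfolding irrefl_def expand_def by blast
  ultimately show ?thesis using finite_expand[OF fin] by (simp add: arc_critical_def)
qed

section \<open>Counting vertices, arcs and digons\<close>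

text \<open>The arcs whose opposite is also present; each digon contributes two of them.\<close>
definition digon_arcs :: "'a rel \<Rightarrow> 'a rel" where
  "digon_arcs A = A \<inter> A\<inverse>"

lemma Field_Times: "C \<noteq> {} \<Longrightarrow> D \<noteq> {} \<Longrightarrow> Field (C \<times> D) = C \<union> D"
  by (auto simp: Field_def)

text \<open>The \<^const>\<open>Field\<close> of the cone over the empty arc set does not contain the apex.\<close>
lemma card_cone:
  assumes "finite B" "irrefl B" "v \<notin> Field B"
  shows "card (Field (cone v B)) = (if B = {} then 0 else card (Field B) + 1)"
    and "card (cone v B) = card B + 2 * card (Field B)"
    and "card (digon_arcs (cone v B)) = card (digon_arcs B) + 2 * card (Field B)"
proof -
  let ?F = "Field B"
  have F: "finite ?F" using assms(1) by (rule finite_Field)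
  have inF: "a \<in> ?F" "b \<in> ?F" "a \<noteq> v" "b \<noteq> v" if "(a, b) \<in> B" for a b
    using FieldI1[OF that] FieldI2[OF that] assms(3) by auto
  have "B = {} \<longleftrightarrow> ?F = {}" by (simp add: Field_def Domain_empty_iff Range_empty_iff)
  moreover have "Field ({v} \<times> ?F) = insert v ?F" "Field (?F \<times> {v}) = insert v ?F" if "?F \<noteq> {}"
    using that by (simp_all add: Field_Times)
  ultimately have "Field (cone v B) = (if B = {} then {} else insert v ?F)"
    by (auto simp: cone_def Field_Un)
  then show "card (Field (cone v B)) = (if B = {} then 0 else card ?F + 1)"
    using assms(3) F by simp
  have count: "card (X \<union> {v} \<times> ?F \<union> ?F \<times> {v}) = card X + 2 * card ?F" if "X \<subseteq> B" for X
  proof -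
    have "finite X" using that assms(1) by (rule finite_subset)
    moreover have "X \<inter> ({v} \<times> ?F) = {}" "(X \<union> {v} \<times> ?F) \<inter> (?F \<times> {v}) = {}"
      using that inF(3) assms(3) by (blast, blast dest: inF(4))
    ultimately show ?thesis using F by (simp add: card_Un_disjoint card_cartesian_product)
  qed
  show "card (cone v B) = card B + 2 * card ?F"
    unfolding cone_def by (rule count) simp
  have "digon_arcs (cone v B) = digon_arcs B \<union> {v} \<times> ?F \<union> ?F \<times> {v}"
    unfolding digon_arcs_def cone_def by (auto dest: inF(3,4))
  then show "card (digon_arcs (cone v B)) = card (digon_arcs B) + 2 * card ?F"
    using count[of "digon_arcs B"] by (simp add: digon_arcs_def)
qed

lemma card_expand:
  assumes "finite A" "irrefl A" "finite B" "Field A \<inter> Field B = {}" "(x, y) \<in> A" "(y, x) \<in> A"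
  shows "card (Field (expand x y A B)) = card (Field A) + card (Field B)"
    and "Suc (card (expand x y A B)) = card A + card B + 2 * card (Field B)"
    and "card (digon_arcs (expand x y A B)) + 2 = card (digon_arcs A) + card (digon_arcs B)"
proof -
  let ?F = "Field B"
  have fF: "finite (Field A)" "finite ?F" using assms(1,3) by (auto intro: finite_Field)
  have nxy: "x \<noteq> y" using assms(2,5) by (auto simp: irrefl_def)
  have xy: "x \<in> Field A" "y \<in> Field A" using assms(5) by (auto simp: Field_def)
  have xyB: "x \<notin> ?F" "y \<notin> ?F" using xy assms(4) by auto
  have inA: "a \<in> Field A" "b \<in> Field A" "a \<notin> ?F" "b \<notin> ?F" if "(a, b) \<in> A" for a b
    using FieldI1[OF that] FieldI2[OF that] assms(4) by auto
  have inB: "a \<in> ?F" "b \<in> ?F" "a \<notin> Field A" "b \<notin> Field A" if "(a, b) \<in> B" for a b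
    using FieldI1[OF that] FieldI2[OF that] assms(4) by auto
  have "A = insert (y, x) (A - {(y, x)})" using assms(6) by blast
  then have "Field A = {y, x} \<union> Field (A - {(y, x)})" by (metis Field_insert)
  moreover have "{y, x} \<subseteq> Field (A - {(y, x)})"
    using assms(5) nxy FieldI1[of x y "A - {(y, x)}"] FieldI2[of x y "A - {(y, x)}"] by auto
  ultimately have FA: "Field (A - {(y, x)}) = Field A" by blast
  have "Field ({y} \<times> ?F) \<subseteq> insert y ?F" "Field (?F \<times> {x}) \<subseteq> insert x ?F"
    unfolding Field_def by auto
  then have "Field (expand x y A B) = Field A \<union> ?F"
    using xy unfolding expand_def Field_Un FA by blast
  then show "card (Field (expand x y A B)) = card (Field A) + card ?F"
    using fF assms(4) by (simp add: card_Un_disjoint)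
  have disj: "(A - {(y, x)}) \<inter> B = {}" "(A - {(y, x)} \<union> B) \<inter> ({y} \<times> ?F) = {}"
    "(A - {(y, x)} \<union> B \<union> {y} \<times> ?F) \<inter> (?F \<times> {x}) = {}"
    using xyB by (auto dest: inA inB)
  have "card (expand x y A B) = card (A - {(y, x)}) + card B + card ?F + card ?F"
    unfolding expand_def using disj fF assms(1,3)
    by (simp add: card_Un_disjoint card_cartesian_product)
  moreover have "Suc (card (A - {(y, x)})) = card A"
    using assms(1,6) by (rule card_Suc_Diff1)
  ultimately show "Suc (card (expand x y A B)) = card A + card B + 2 * card ?F" by simp
  have "digon_arcs (expand x y A B) = (digon_arcs A - {(x, y), (y, x)}) \<union> digon_arcs B"
    using inA inB xy xyB nxy unfolding digon_arcs_def expand_def by blast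
  moreover have "(digon_arcs A - {(x, y), (y, x)}) \<inter> digon_arcs B = {}"
    using inA inB unfolding digon_arcs_def by blast
  moreover have fd: "finite (digon_arcs A)" "finite (digon_arcs B)"
    using assms(1,3) by (auto simp: digon_arcs_def)
  ultimately have "card (digon_arcs (expand x y A B))
      = card (digon_arcs A - {(x, y), (y, x)}) + card (digon_arcs B)"
    by (simp add: card_Un_disjoint)
  moreover have sub: "{(x, y), (y, x)} \<subseteq> digon_arcs A" using assms(5,6) by (auto simp: digon_arcs_def)
  have "card (digon_arcs A - {(x, y), (y, x)}) + 2 = card (digon_arcs A)"
    using card_Diff_subset[OF _ sub] card_mono[OF fd(1) sub] nxy by simp
  ultimately show "card (digon_arcs (expand x y A B)) + 2 = card (digon_arcs A) + card (digon_arcs B)"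
    by simp
qed

section \<open>Directed cycles of length two and three\<close>

lemma colourable_one: "colourable 1 A \<longleftrightarrow> acyclic A"
proof -
  have all: "mono_arcs c A = A" if "\<forall>v. c v \<in> {1..1}" for c :: "'a \<Rightarrow> nat"
  proof -
    have "c v = 1" for v using that by auto
    then show ?thesis by (simp add: mono_arcs_def)
  qed
  show ?thesis
    unfolding colourable_def using all all[of "\<lambda>_. 1"] by (metis atLeastAtMost_iff le_refl)
qed

lemma arc_critical_two_cycle:
  assumes "a \<noteq> b"
  shows "arc_critical 1 {(a, b), (b, a)}"
proof -
  have "(a, a) \<in> {(a, b), (b, a)}\<^sup>+"
    by (rule trancl_into_trancl[OF r_into_trancl, of _ b]) simp_all
  then have "\<not> acyclic {(a, b), (b, a)}" by (auto simp: acyclic_def)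
  then show ?thesis
    using assms by (auto simp: arc_critical_def colourable_one[unfolded One_nat_def] irrefl_def
        insert_Diff_if acyclic_insert acyclic_def[of "{}"])
qed

lemma arc_critical_three_cycle:
  assumes "a \<noteq> b" "b \<noteq> c" "c \<noteq> a"
  shows "arc_critical 1 {(a, b), (b, c), (c, a)}"
proof -
  have "(a, a) \<in> {(a, b), (b, c), (c, a)}\<^sup>+"
    by (rule trancl_into_trancl[OF trancl_into_trancl[OF r_into_trancl], of _ b _ c]) simp_all
  then have "\<not> acyclic {(a, b), (b, c), (c, a)}" by (auto simp: acyclic_def)
  moreover have ac: "acyclic {(p, q), (q, r)}" if "p \<noteq> q" "q \<noteq> r" "r \<noteq> p" for p q r :: 'a
    by (rule acyclic_lex_rank[where g = "\<lambda>v. (if v = p then 0 else if v = q then 1 else 2, 0)"])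
      (use that in auto)
  moreover have "acyclic ({(a, b), (b, c), (c, a)} - {e})"
    if e: "e \<in> {(a, b), (b, c), (c, a)}" for e
  proof -
    from e consider "e = (a, b)" | "e = (b, c)" | "e = (c, a)" by blast
    then show ?thesis
    proof cases
      case 1
      then show ?thesis by (intro acyclic_subset[OF ac[OF assms(2,3,1)]]) blast
    next
      case 2
      then show ?thesis by (intro acyclic_subset[OF ac[OF assms(3,1,2)]]) blast
    next
      case 3
      then show ?thesis by (intro acyclic_subset[OF ac[OF assms]]) blast
    qed
  qed
  ultimately show ?thesis
    using assms unfolding arc_critical_def colourable_one by (simp add: irrefl_def)
qed

section \<open>Digraphs presented by their arcs\<close>

text \<open>The digraph without isolated vertices that has the arc set \<open>A\<close>.\<close>
definition arc_digraph :: "'a rel \<Rightarrow> ('a, 'a \<times> 'a) pre_digraph" where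
  "arc_digraph A = \<lparr>verts = Field A, arcs = A, tail = fst, head = snd\<rparr>"

lemma arc_digraph_simps [simp]:
  "verts (arc_digraph A) = Field A" "arcs (arc_digraph A) = A"
  "tail (arc_digraph A) = fst" "head (arc_digraph A) = snd"
  by (simp_all add: arc_digraph_def)

lemma arcs_ends_arc_digraph [simp]: "arcs_ends (arc_digraph A) = A"
  by (simp add: arcs_ends_def arc_to_ends_def)

lemma digraph_arc_digraph:
  assumes "finite A" "irrefl A"
  shows "digraph (arc_digraph A)"
proof unfold_locales
  show "tail (arc_digraph A) e \<in> verts (arc_digraph A)" "head (arc_digraph A) e \<in> verts (arc_digraph A)"
    if "e \<in> arcs (arc_digraph A)" for e
    using that by (cases e; auto intro: FieldI1 FieldI2)+
  show "finite (verts (arc_digraph A))" "finite (arcs (arc_digraph A))"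
    using assms(1) by (simp_all add: finite_Field)
qed (use assms(2) in \<open>auto simp: irrefl_def arc_to_ends_def\<close>)

lemma acyclic_digraph_iff:
  assumes "wf_digraph G"
  shows "acyclic_digraph G \<longleftrightarrow> acyclic (arcs_ends G)"
proof -
  have "(\<exists>p. pre_digraph.cycle G p) \<longleftrightarrow> (\<exists>p. wf_digraph.closed_w G p)"
    using wf_digraph.closed_w_imp_cycle[OF assms] by (auto simp: wf_digraph.cycle_altdef[OF assms])
  also have "\<dots> \<longleftrightarrow> (\<exists>u. u \<rightarrow>\<^sup>+\<^bsub>G\<^esub> u)"
    by (auto simp: wf_digraph.closed_w_def[OF assms] wf_digraph.reachable1_awalk[OF assms])
  finally show ?thesis by (simp add: acyclic_digraph_def acyclic_def)
qed

lemma dicolouring_subgraph_iff: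
  assumes "subgraph H (arc_digraph A)"
  shows "dicolouring k H c \<longleftrightarrow>
    (\<forall>v \<in> verts H. c v \<in> {1..k}) \<and> acyclic (mono_arcs c (arcs H))"
proof -
  have wf: "wf_digraph H" and th: "tail H = fst" "head H = snd"
    using assms by (auto simp: subgraph_def compatible_def)
  have inV: "u \<in> verts H \<and> v \<in> verts H" if "(u, v) \<in> arcs H" for u v
    using wf_digraph.wellformed[OF wf that] th by simp
  let ?K = "\<lambda>i. {(u, v) \<in> arcs H. c u = i \<and> c v = i}"
  have "acyclic_digraph (H \<restriction> {v \<in> verts H. c v = i}) \<longleftrightarrow> acyclic (?K i)" for i
  proof -
    have "arcs_ends (H \<restriction> {v \<in> verts H. c v = i}) = ?K i"
      using inV by (force simp: arcs_ends_def arc_to_ends_def th)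
    then show ?thesis
      by (simp add: acyclic_digraph_iff wf_digraph.wellformed_induce_subgraph[OF wf])
  qed
  moreover have "(\<forall>i \<in> {1..k}. acyclic (?K i)) \<longleftrightarrow> acyclic (mono_arcs c (arcs H))"
    if cv: "\<forall>v \<in> verts H. c v \<in> {1..k}"
  proof
    assume K: "\<forall>i \<in> {1..k}. acyclic (?K i)"
    have path: "c v = c u \<and> (u, v) \<in> (?K (c u))\<^sup>+" if "(u, v) \<in> (mono_arcs c (arcs H))\<^sup>+" for u v
      using that
    proof (induction rule: trancl_induct)
      case (base v)
      then show ?case by (auto simp: mono_arcs_def)
    next
      case (step v w)
      then have "c w = c u" "(v, w) \<in> ?K (c u)" by (auto simp: mono_arcs_def)
      with step show ?case by (meson trancl_into_trancl)
    qed
    show "acyclic (mono_arcs c (arcs H))"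
    proof (rule acyclicI, intro allI notI)
      fix u assume u: "(u, u) \<in> (mono_arcs c (arcs H))\<^sup>+"
      then obtain w where "(u, w) \<in> mono_arcs c (arcs H)" by (meson tranclD)
      then have "c u \<in> {1..k}" using inV cv by (auto simp: mono_arcs_def)
      then show False using path[OF u] K by (auto simp: acyclic_def)
    qed
  next
    assume "acyclic (mono_arcs c (arcs H))"
    moreover have "?K i \<subseteq> mono_arcs c (arcs H)" for i by (auto simp: mono_arcs_def)
    ultimately show "\<forall>i \<in> {1..k}. acyclic (?K i)" using acyclic_subset by blast
  qed
  ultimately show ?thesis unfolding dicolouring_def by blast
qed

text \<open>
  Since there are no isolated vertices, every proper subdigraph misses an arc; hence it suffices
  to colour the arc sets that arise by deleting one arc.
\<close>
lemma dicritical_arc_digraph: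
  assumes crit: "arc_critical k A" and "k \<ge> 1"
  shows "dicritical (Suc k) (arc_digraph A)"
proof -
  have fin: "finite A" "irrefl A" and nc: "\<not> colourable k A"
    using crit by (auto simp: arc_critical_def)
  have D: "digraph (arc_digraph A)" using fin by (rule digraph_arc_digraph)
  then have "wf_digraph (arc_digraph A)" by (simp add: digraph_def fin_digraph_def)
  then have self: "subgraph (arc_digraph A) (arc_digraph A)"
    by (simp add: subgraph_def compatible_def)
  obtain c where "\<And>v. c v \<in> {1..Suc k}" "acyclic (mono_arcs c A)"
    using arc_critical_coloured[OF crit] by metis
  then have "dicolouring (Suc k) (arc_digraph A) c"
    using dicolouring_subgraph_iff[OF self] by simp
  moreover have "Suc k \<le> m" if m: "dicolouring m (arc_digraph A) c" for m c
  proof (rule ccontr)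
    assume "\<not> Suc k \<le> m"
    moreover have "c ` Field A \<subseteq> {1..m}" "acyclic (mono_arcs c A)"
      using m dicolouring_subgraph_iff[OF self] by auto
    ultimately have "colourable k A"
      using colourableI_palette[of c A "{1..m}" k] \<open>k \<ge> 1\<close> by simp
    then show False using nc by simp
  qed
  ultimately have "dichromatic_number (arc_digraph A) = Suc k"
    unfolding dichromatic_number_def by (intro Least_equality) auto
  moreover have "dichromatic_number H < Suc k" if H: "proper_subdigraph H (arc_digraph A)" for H
  proof -
    have sub: "subgraph H (arc_digraph A)" using H by (simp add: proper_subdigraph_def)
    have HA: "arcs H \<subseteq> A" "verts H \<subseteq> Field A" using sub by (auto simp: subgraph_def)
    have "arcs H \<noteq> A"
    proof
      assume eq: "arcs H = A"
      have "wf_digraph H" "tail H = fst" "head H = snd"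
        using sub by (auto simp: subgraph_def compatible_def)
      then have "Field A \<subseteq> verts H"
        using eq wf_digraph.wellformed[of H] by (fastforce simp: Field_def)
      then show False using H eq HA by (auto simp: proper_subdigraph_def)
    qed
    then obtain e where "e \<in> A" "arcs H \<subseteq> A - {e}" using HA by blast
    then have "colourable k (arcs H)"
      using crit colourable_mono unfolding arc_critical_def by blast
    then obtain c where "dicolouring k H c"
      using dicolouring_subgraph_iff[OF sub] by (auto simp: colourable_def)
    then have "dichromatic_number H \<le> k"
      unfolding dichromatic_number_def by (intro Least_le) blast
    then show ?thesis by simp
  qed
  ultimately show ?thesis by (simp add: dicritical_def D)
qed

lemma oriented_graph_arc_digraph:
  assumes "finite A" "irrefl A" "digon_arcs A = {}"
  shows "oriented_graph (arc_digraph A)"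
proof (intro oriented_graph.intro oriented_graph_axioms.intro)
  show "digraph (arc_digraph A)" using assms(1,2) by (rule digraph_arc_digraph)
  show "\<not> v \<rightarrow>\<^bsub>arc_digraph A\<^esub> u" if "u \<rightarrow>\<^bsub>arc_digraph A\<^esub> v" for u v
    using that assms(3) by (auto simp: digon_arcs_def)
qed

section \<open>Existence of critical digraphs with given numbers of vertices and arcs\<close>

text \<open>
  Some 3-dicritical digraph has \<open>n\<close> vertices, \<open>m\<close> arcs and \<open>d\<close> arcs lying in digons. These numbers
  are all that has to be tracked, as the expansions may be applied to an arbitrary digon.
\<close>
definition has_critical :: "nat \<Rightarrow> nat \<Rightarrow> nat \<Rightarrow> bool" where
  "has_critical n m d \<longleftrightarrow> (\<exists>A :: nat rel. arc_critical 2 A \<and>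
     card (Field A) = n \<and> card A = m \<and> card (digon_arcs A) = d)"

lemma fresh_two_cycle:
  assumes "finite (F :: nat set)"
  obtains B :: "nat rel" where "arc_critical 1 B" "F \<inter> Field B = {}"
    "card (Field B) = 2" "card B = 2" "card (digon_arcs B) = 2"
proof -
  obtain a where a: "\<forall>i \<in> F. i < a" using finite_nat_set_iff_bounded[THEN iffD1, OF assms] by blast
  let ?B = "{(a, a + 1), (a + 1, a)}"
  have "Field ?B = {a, a + 1}" "digon_arcs ?B = ?B" by (auto simp: digon_arcs_def)
  moreover have "F \<inter> {a, a + 1} = {}" using a by force
  ultimately show thesis
    by (intro that[of ?B]) (simp_all add: arc_critical_two_cycle del: One_nat_def)
qed

lemma fresh_three_cycle:
  assumes "finite (F :: nat set)"
  obtains B :: "nat rel" where "arc_critical 1 B" "F \<inter> Field B = {}"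
    "card (Field B) = 3" "card B = 3" "card (digon_arcs B) = 0"
proof -
  obtain a where a: "\<forall>i \<in> F. i < a" using finite_nat_set_iff_bounded[THEN iffD1, OF assms] by blast
  let ?B = "{(a, a + 1), (a + 1, a + 2), (a + 2, a)}"
  have "Field ?B = {a, a + 1, a + 2}" "digon_arcs ?B = {}" by (auto simp: digon_arcs_def)
  moreover have "F \<inter> {a, a + 1, a + 2} = {}" using a by force
  ultimately show thesis
    by (intro that[of ?B]) (simp_all add: arc_critical_three_cycle del: One_nat_def)
qed

lemma has_critical_cone:
  assumes "arc_critical 1 (B :: nat rel)"
  shows "has_critical (card (Field B) + 1) (card B + 2 * card (Field B))
    (card (digon_arcs B) + 2 * card (Field B))"
proof -
  have B: "finite B" "irrefl B" "\<not> colourable 1 B" using assms by (auto simp: arc_critical_def)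
  then have "B \<noteq> {}" unfolding colourable_one by (auto simp: acyclic_def)
  obtain v where v: "v \<notin> Field B" using finite_Field[OF B(1)] ex_new_if_finite infinite_UNIV_nat by blast
  show ?thesis
    unfolding has_critical_def
    using arc_critical_cone[OF assms _ v] card_cone[OF B(1,2) v] \<open>B \<noteq> {}\<close>
    by (intro exI[of _ "cone v B"]) (simp add: numeral_2_eq_2)
qed

lemma has_critical_bases: "has_critical 3 6 6" "has_critical 4 9 6"
proof -
  obtain B :: "nat rel" where "arc_critical 1 B"
    "card (Field B) = 2" "card B = 2" "card (digon_arcs B) = 2"
    using fresh_two_cycle[of "{}"] by auto
  then show "has_critical 3 6 6" using has_critical_cone[of B] by simp
  obtain B :: "nat rel" where "arc_critical 1 B"
    "card (Field B) = 3" "card B = 3" "card (digon_arcs B) = 0"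
    using fresh_three_cycle[of "{}"] by auto
  then show "has_critical 4 9 6" using has_critical_cone[of B] by simp
qed

lemma has_critical_expand:
  assumes "has_critical n m d" "d > 0"
  shows "has_critical (n + 2) (m + 5) d" "has_critical (n + 3) (m + 8) (d - 2)"
proof -
  obtain A :: "nat rel" where A: "arc_critical 2 A" "card (Field A) = n" "card A = m"
    "card (digon_arcs A) = d"
    using assms(1) by (auto simp: has_critical_def)
  have fin: "finite A" "irrefl A" using A(1) by (auto simp: arc_critical_def)
  have "digon_arcs A \<noteq> {}" using A(4) assms(2) by auto
  then obtain x y where xy: "(x, y) \<in> A" "(y, x) \<in> A" by (auto simp: digon_arcs_def)
  have step: "has_critical n' m' d'"
    if B: "arc_critical 1 B" "Field A \<inter> Field B = {}"
      and "n' = n + card (Field B)" "Suc m' = m + card B + 2 * card (Field B)"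
        "d' + 2 = d + card (digon_arcs B)"
    for n' m' d' and B :: "nat rel"
  proof -
    have "finite B" using B(1) by (simp add: arc_critical_def)
    note c = card_expand[OF fin this B(2) xy]
    have "arc_critical 2 (expand x y A B)"
      using arc_critical_expand[OF A(1)[folded Suc_1] B(1) order_refl B(2) xy] by (simp only: Suc_1)
    then show ?thesis
      unfolding has_critical_def using c that A by (intro exI[of _ "expand x y A B"]) auto
  qed
  obtain B :: "nat rel" where "arc_critical 1 B" "Field A \<inter> Field B = {}"
    "card (Field B) = 2" "card B = 2" "card (digon_arcs B) = 2"
    using fresh_two_cycle[OF finite_Field[OF fin(1)]] by metis
  then show "has_critical (n + 2) (m + 5) d" using step[of B "n + 2" "m + 5" d] by simp
  obtain B :: "nat rel" where B: "arc_critical 1 B" "Field A \<inter> Field B = {}"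
    "card (Field B) = 3" "card B = 3" "card (digon_arcs B) = 0"
    using fresh_three_cycle[OF finite_Field[OF fin(1)]] by metis
  have "{(x, y), (y, x)} \<subseteq> digon_arcs A" "x \<noteq> y"
    using xy fin(2) by (auto simp: digon_arcs_def irrefl_def)
  then have "2 \<le> d"
    using card_mono[of "digon_arcs A" "{(x, y), (y, x)}"] fin(1) A(4) by (simp add: digon_arcs_def)
  then show "has_critical (n + 3) (m + 8) (d - 2)" using step[OF B(1,2), of "n + 3" "m + 8" "d - 2"] B by simp
qed

text \<open>Three digons remain during the first \<open>k\<close> expansions; the last three destroy them.\<close>
lemma has_critical_oriented:
  assumes "has_critical n m 6"
  shows "has_critical (n + 2 * k + 9) (m + 5 * k + 24) 0"
proof -
  have "has_critical (n + 2 * k) (m + 5 * k) 6"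
  proof (induction k)
    case 0
    then show ?case using assms by simp
  next
    case (Suc k)
    then show ?case using has_critical_expand(1)[OF Suc] by (simp add: algebra_simps)
  qed
  from has_critical_expand(2)[OF this] have "has_critical (n + 2 * k + 3) (m + 5 * k + 8) 4"
    by simp
  from has_critical_expand(2)[OF this] have "has_critical (n + 2 * k + 6) (m + 5 * k + 16) 2"
    by (simp add: add.commute add.left_commute)
  from has_critical_expand(2)[OF this] show ?thesis
    by (simp add: add.commute add.left_commute)
qed

theorem corollary4p3:
  fixes n :: nat
  assumes "n \<ge> 12"
  shows "(\<exists>D :: (nat, nat \<times> nat) pre_digraph.
            oriented_graph D \<and> dicritical 3 D \<and> card (verts D) = n \<and>
            int (card (arcs D)) = \<lceil>5 / 2 * real n\<rceil>) \<and>
         min_arcs_dicritical_oriented 3 n \<le> enat (nat \<lceil>5 / 2 * real n\<rceil>)"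
proof -
  have "\<exists>m. has_critical n m 0 \<and> int m = \<lceil>5 / 2 * real n\<rceil>"
  proof (cases "even n")
    case True
    then have "n = 12 + 2 * ((n - 12) div 2)" using assms by auto
    then obtain k where k: "n = 12 + 2 * k" by blast
    have "has_critical n (30 + 5 * k) 0"
      using has_critical_oriented[OF has_critical_bases(1), of k] k by (simp add: add.commute)
    moreover have "\<lceil>5 / 2 * real n\<rceil> = int (30 + 5 * k)"
      unfolding k by (rule ceiling_unique) auto
    ultimately show ?thesis by auto
  next
    case False
    then have "n = 13 + 2 * ((n - 13) div 2)" using assms by presburger
    then obtain k where k: "n = 13 + 2 * k" by blast
    have "has_critical n (33 + 5 * k) 0"
      using has_critical_oriented[OF has_critical_bases(2), of k] k by (simp add: add.commute)
    moreover have "\<lceil>5 / 2 * real n\<rceil> = int (33 + 5 * k)"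
      unfolding k by (rule ceiling_unique) auto
    ultimately show ?thesis by auto
  qed
  then obtain A :: "nat rel" where A: "arc_critical 2 A" "card (Field A) = n"
    "int (card A) = \<lceil>5 / 2 * real n\<rceil>" "card (digon_arcs A) = 0"
    by (auto simp: has_critical_def)
  have fin: "finite A" "irrefl A" using A(1) by (auto simp: arc_critical_def)
  have "digon_arcs A = {}" using A(4) fin(1) by (auto simp: digon_arcs_def)
  then have D: "oriented_graph (arc_digraph A)" "dicritical 3 (arc_digraph A)"
    using oriented_graph_arc_digraph[OF fin] dicritical_arc_digraph[OF A(1)]
    by (simp_all add: numeral_3_eq_3 numeral_2_eq_2)
  have "min_arcs_dicritical_oriented 3 n \<le> enat (card A)"
    unfolding min_arcs_dicritical_oriented_def
    by (rule Inf_lower, rule CollectI, rule exI[of _ "arc_digraph A"]) (use D A(2) in simp)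
  moreover have "card A = nat \<lceil>5 / 2 * real n\<rceil>" using A(3) by linarith
  ultimately show ?thesis
    using D A by (intro conjI exI[of _ "arc_digraph A"]) auto
qed

end
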